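(* Let $0<\epsilon<\tau<1$. Consider a discrete update taking the belief from $b^-$ to $b^+$, with the robot state $x\in\mathcal X$ unchanged. Suppose that before the update $(x,b^-)\in\mathcal C_b^{\tau-\epsilon}$. If the update satisfies $$\Lambda(\mathcal F(x),b^+)-\Lambda(\mathcal F(x),b^-)\ \le\ \ln\Bigl(1+\frac{\epsilon}{1-\tau}\Bigr),$$ then, in the limit $\kappa\to\infty$ (i.e. with the barrier function defining the safe sets taken to be its limit as $\kappa\to\infty$), $(x,b^+)\in\mathcal C_b^{\tau}$.
   Context: A belief consists of a particle tuple $b=(\tilde o^{(1)},\dots,\tilde o^{(L)})\in\mathcal B\subseteq\mathbb R^{L n_o}$, $\tilde o^{(i)}\in\mathcal O\subseteq\mathbb R^{n_o}$, together with a uniform weight $w>0$ shared by all particles. The weight may change at an update; let $w^-$ and $w^+$ be the weights accompanying $b^-$ and $b^+$. The robot state is $x\in\mathcal X\subseteq\mathbb R^{n_x}$. The update map $b^-\mapsto b^+$ is otherwise arbitrary (possibly discontinuous). Let $h_o:\mathbb R^{n_x}\times\mathbb R^{n_o}\to\mathbb R$ be a smooth single-object safety function, $\mathcal F(x)=\{o\in\mathcal O: h_o(x,o)<0\}$ the failure set, and $s_i(x,b)=h_o(x,\tilde o^{(i)})$. The total particle weight in the failure set is $$\Lambda(\mathcal F(x),b)=\sum_{i=1}^L w\,\mathbf 1\{h_o(x,\tilde o^{(i)})<0\},$$ where $w$ is the weight accompanying $b$ (so $w^-$ for $b^-$ and $w^+$ for $b^+$). For a risk level $\sigma\in(0,1)$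 let $k_\sigma=\min\{L,\lfloor\frac1w\ln\frac1{1-\sigma}\rfloor\}$, with $w$ the weight accompanying $b$. Let $s_{(1)}\le\dots\le s_{(L)}$ be the order statistics of $s_1,\dots,s_L$ and $\mathcal I^\star$ an index set of cardinality $L-k_\sigma$ indexing the top values $s_{(k_\sigma+1)},\dots,s_{(L)}$. For $\kappa>0$ the belief control barrier function at risk level $\sigma$ is $$h_b(x,b)=-\frac1\kappa\ln\Bigl(\sum_{i\in\mathcal I^\star}e^{-\kappa s_i(x,b)}\Bigr),$$ and $\mathcal C_b^{\sigma}=\{(x,b)\in\mathcal X\times\mathcal B: h_b(x,b)\ge0\}$ is the safe set constructed with risk level $\sigma$. As $\kappa\to\infty$, $h_b(x,b)$ converges to $\min_{i\in\mathcal I^\star}s_i(x,b)=s_{(k_\sigma+1)}$ (with the convention $\min\emptyset=+\infty$ when $k_\sigma=L$), so in the limit $\mathcal C_b^\sigma$ is the set of $(x,b)$ with $\min_{i\in\mathcal I^\star}s_i(x,b)\ge0$. *)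

theory Defs
  imports "HOL-Analysis.Analysis"
begin

(* Class C^k on the whole (finite-dimensional) space, via iterated Frechet derivatives evaluated in
   arbitrary fixed directions. *)
primrec C_k :: "nat \<Rightarrow> ('a::euclidean_space \<Rightarrow> real) \<Rightarrow> bool" where
  "C_k 0 f \<longleftrightarrow> continuous_on UNIV f"
| "C_k (Suc k) f \<longleftrightarrow>
     (\<forall>x. f differentiable (at x)) \<and> (\<forall>v. C_k k (\<lambda>x. frechet_derivative f (at x) v))"

definition smooth :: "('a::euclidean_space \<Rightarrow> real) \<Rightarrow> bool" where
  "smooth f \<longleftrightarrow> (\<forall>k. C_k k f)"

(* A belief of L = CARD('l) particles in R^{n_o}; its uniform weight is passed separately. *)
type_synonym ('no, 'l) belief = "((real, 'no) vec, 'l) vec"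

definition failure_set ::
    "(real^'nx \<Rightarrow> real^'no \<Rightarrow> real) \<Rightarrow> (real^'no) set \<Rightarrow> real^'nx \<Rightarrow> (real^'no) set" where
  "failure_set h\<^sub>o Obj x = {y \<in> Obj. h\<^sub>o x y < 0}"

definition particle_weight ::
    "(real^'no) set \<Rightarrow> real \<Rightarrow> ('no::finite, 'l::finite) belief \<Rightarrow> real" where
  "particle_weight A w b = (\<Sum>i\<in>UNIV. w * of_bool (b $ i \<in> A))"

lemma particle_weight_failure_set:
  assumes "\<And>i. b $ i \<in> Obj"
  shows "particle_weight (failure_set h\<^sub>o Obj x) w b = (\<Sum>i\<in>UNIV. w * of_bool (h\<^sub>o x (b $ i) < 0))"
  using assms by (simp add: particle_weight_def failure_set_def)

(* The floor is nonnegative for w > 0 and 0 < \<sigma> < 1, so nat does not truncate. *)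
definition risk_index :: "nat \<Rightarrow> real \<Rightarrow> real \<Rightarrow> nat" where
  "risk_index L w \<sigma> = min L (nat \<lfloor>(1 / w) * ln (1 / (1 - \<sigma>))\<rfloor>)"

(* The j-th smallest value (with multiplicity) of the family s, for 1 \<le> j \<le> CARD('l). *)
definition order_stat :: "('l::finite \<Rightarrow> real) \<Rightarrow> nat \<Rightarrow> real" where
  "order_stat s j = sorted_list_of_multiset (image_mset s (mset_set UNIV)) ! (j - 1)"

definition is_top_index_set :: "nat \<Rightarrow> ('l::finite \<Rightarrow> real) \<Rightarrow> 'l set \<Rightarrow> bool" where
  "is_top_index_set k s I \<longleftrightarrow>
     card I = CARD('l) - k \<and>
     image_mset s (mset_set I) = image_mset (order_stat s) (mset_set {k + 1..CARD('l)})"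

(* With ties there are several such sets; all of them give the same multiset of values and hence
   the same barrier below. *)
definition top_index_set :: "nat \<Rightarrow> ('l::finite \<Rightarrow> real) \<Rightarrow> 'l set" where
  "top_index_set k s = (SOME I. is_top_index_set k s I)"

(* The values are extended reals because for an empty index set the sum is 0 and
   -(1/\<kappa>) ln 0 is read as \<infinity>. *)
definition belief_cbf ::
    "(real^'nx \<Rightarrow> real^'no \<Rightarrow> real) \<Rightarrow> real \<Rightarrow> real \<Rightarrow> real \<Rightarrow> real^'nx
      \<Rightarrow> ('no::finite, 'l::finite) belief \<Rightarrow> ereal" where
  "belief_cbf h\<^sub>o \<kappa> w \<sigma> x b =
     (let s = (\<lambda>i. h\<^sub>o x (b $ i));
          I = top_index_set (risk_index CARD('l) w \<sigma>) s
      in if I = {} then \<infinity> else ereal (- (1 / \<kappa>) * ln (\<Sum>i\<in>I. exp (- \<kappa> * s i))))"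

(* Lim is well defined here: the limit always exists in ereal, being \<infinity> for an empty index set and
   the minimum of the selected values otherwise. *)
definition limit_belief_cbf ::
    "(real^'nx \<Rightarrow> real^'no \<Rightarrow> real) \<Rightarrow> real \<Rightarrow> real \<Rightarrow> real^'nx
      \<Rightarrow> ('no::finite, 'l::finite) belief \<Rightarrow> ereal" where
  "limit_belief_cbf h\<^sub>o w \<sigma> x b = Lim at_top (\<lambda>\<kappa>. belief_cbf h\<^sub>o \<kappa> w \<sigma> x b)"

definition safe_set :: "'x set \<Rightarrow> 'b set \<Rightarrow> ('x \<Rightarrow> 'b \<Rightarrow> ereal) \<Rightarrow> ('x \<times> 'b) set" where
  "safe_set X B h = {(x, b) \<in> X \<times> B. h x b \<ge> 0}"

end

theory Submission
  imports Defs
begin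

text \<open>
  Let N be the number of particles with negative safety value. In the limit, the barrier is the
  least selected value, so it is nonnegative iff N is at most the risk index, that is, iff the
  weight w N of the failure set is at most ln (1 / (1 - \<sigma>)). The risk budgets telescope:
  ln (1 / (1 - \<tau> + \<epsilon>)) + ln (1 + \<epsilon> / (1 - \<tau>)) = ln (1 / (1 - \<tau>)).
\<close>

text \<open>In a sorted list the negative entries form a prefix, so dropping \<open>k\<close>
  entries removes them all exactly when there are at most \<open>k\<close> of them.\<close>

lemma sorted_drop_nonneg_iff:
  fixes xs :: "'a::{linorder,zero} list"
  assumes "sorted xs"
  shows "(\<forall>y\<in>set (drop k xs). 0 \<le> y) \<longleftrightarrow> length (filter (\<lambda>y. y < 0) xs) \<le> k"
proof
  assume nonneg: "\<forall>y\<in>set (drop k xs). 0 \<le> y"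
  have "filter (\<lambda>y. y < 0) xs
      = filter (\<lambda>y. y < 0) (take k xs) @ filter (\<lambda>y. y < 0) (drop k xs)"
    by (metis append_take_drop_id filter_append)
  also have "filter (\<lambda>y. y < 0) (drop k xs) = []"
    using nonneg by (auto simp: filter_empty_conv not_less)
  finally have "length (filter (\<lambda>y. y < 0) xs) \<le> length (take k xs)"
    by (metis append_Nil2 length_filter_le)
  then show "length (filter (\<lambda>y. y < 0) xs) \<le> k"
    by simp
next
  assume few: "length (filter (\<lambda>y. y < 0) xs) \<le> k"
  show "\<forall>y\<in>set (drop k xs). 0 \<le> y"
  proof (rule ccontr)
    assume "\<not> ?thesis"
    then obtain j where j: "k + j < length xs" "xs ! (k + j) < 0"
      by (auto simp: in_set_conv_nth not_le less_diff_conv add.commute)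
    \<comment> \<open>By sortedness, a negative entry at position \<open>k + j\<close> makes all
      \<open>k + j + 1\<close> entries up to it negative, which is already more than
      \<open>k\<close>.\<close>
    have "y < 0" if "y \<in> set (take (Suc (k + j)) xs)" for y
    proof -
      from that obtain i where "i \<le> k + j" "y = xs ! i"
        by (auto simp: in_set_conv_nth less_Suc_eq_le)
      then show ?thesis
        using sorted_nth_mono[OF assms, of i "k + j"] j by auto
    qed
    then have "length (filter (\<lambda>y. y < 0) (take (Suc (k + j)) xs)) = Suc (k + j)"
      using j by simp
    moreover have "filter (\<lambda>y. y < 0) xs = filter (\<lambda>y. y < 0) (take (Suc (k + j)) xs)
        @ filter (\<lambda>y. y < 0) (drop (Suc (k + j)) xs)"
      by (metis append_take_drop_id filter_append)
    ultimately show False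
      using few by simp
  qed
qed

text \<open>Ranks count from 1 and list positions from 0, so the ranks from \<open>k + 1\<close> on
  are the positions from \<open>k\<close> on. This trades order statistics for a suffix of the
  sorted list.\<close>

lemma image_mset_order_stat:
  fixes s :: "'l::finite \<Rightarrow> real"
  shows "image_mset (order_stat s) (mset_set {k + 1..CARD('l)})
      = mset (drop k (sorted_list_of_multiset (image_mset s (mset_set UNIV))))"
proof -
  let ?xs = "sorted_list_of_multiset (image_mset s (mset_set UNIV))"
  have len: "length ?xs = CARD('l)"
    by (metis mset_sorted_list_of_multiset size_image_mset size_mset size_mset_set)
  have "mset_set {k + 1..CARD('l)} = mset [k + 1..<CARD('l) + 1]"
    by (metis Suc_eq_plus1 atLeastLessThanSuc_atLeastAtMost mset_upt)
  then have "image_mset (order_stat s) (mset_set {k + 1..CARD('l)})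
      = mset (map (order_stat s) [k + 1..<CARD('l) + 1])"
    by simp
  also have "map (order_stat s) [k + 1..<CARD('l) + 1] = drop k ?xs"
    using len by (intro nth_equalityI) (auto simp: order_stat_def simp del: upt_Suc)
  finally show ?thesis .
qed

text \<open>Needed because \<open>top_index_set\<close> is a \<open>SOME\<close> choice. The witness
  is obtained by sorting the indices by their value and discarding the first
  \<open>k\<close>.\<close>

lemma is_top_index_set_exists:
  fixes s :: "'l::finite \<Rightarrow> real"
  shows "\<exists>I. is_top_index_set k s I"
proof -
  obtain qs where qs: "set qs = (UNIV :: 'l set)" "distinct qs"
    using finite_distinct_list[of "UNIV :: 'l set"] by auto
  \<comment> \<open>Sorting indices instead of values breaks ties and keeps the entries distinct, so
    that the suffix has the right cardinality as a set.\<close>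
  define ps where "ps = sort_key s qs"
  have ps: "distinct ps" "mset ps = mset_set UNIV" "sorted (map s ps)"
    using qs mset_set_set[of qs] by (auto simp: ps_def)
  have len: "length ps = CARD('l)"
    by (metis ps(2) size_mset size_mset_set)
  have "sorted_list_of_multiset (image_mset s (mset_set UNIV)) = map s ps"
    using ps by (metis mset_map sorted_list_of_multiset_mset sorted_sort_id)
  moreover have "mset_set (set (drop k ps)) = mset (drop k ps)"
    using ps(1) by (simp add: mset_set_set)
  ultimately have "is_top_index_set k s (set (drop k ps))"
    using ps(1) len
    unfolding is_top_index_set_def image_mset_order_stat
    by (simp add: drop_map distinct_card)
  then show ?thesis ..
qed

text \<open>Whichever admissible set is chosen, its values are those of the sorted list after the
  first \<open>k\<close> entries, so ties do not affect the criterion.\<close>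

lemma top_index_set_nonneg_iff:
  fixes s :: "'l::finite \<Rightarrow> real"
  shows "(\<forall>i\<in>top_index_set k s. 0 \<le> s i) \<longleftrightarrow> card {i. s i < 0} \<le> k"
proof -
  let ?xs = "sorted_list_of_multiset (image_mset s (mset_set UNIV))"
  have "is_top_index_set k s (top_index_set k s)"
    unfolding top_index_set_def by (rule someI_ex[OF is_top_index_set_exists])
  then have "image_mset s (mset_set (top_index_set k s)) = mset (drop k ?xs)"
    unfolding is_top_index_set_def image_mset_order_stat by blast
  then have "set (drop k ?xs) = s ` top_index_set k s"
    by (metis finite finite_set_mset_mset_set set_image_mset set_mset_mset)
  moreover have "length (filter (\<lambda>y. y < 0) ?xs) = card {i. s i < 0}"
  proof -
    have "length (filter (\<lambda>y. y < 0) ?xs)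
        = size (filter_mset (\<lambda>y. y < 0) (image_mset s (mset_set UNIV)))"
      by (metis mset_filter mset_sorted_list_of_multiset size_mset)
    then show ?thesis
      by (simp add: filter_mset_image_mset)
  qed
  ultimately show ?thesis
    using sorted_drop_nonneg_iff[OF sorted_sorted_list_of_multiset, of k "image_mset s (mset_set UNIV)"]
    by auto
qed

text \<open>With m the minimum and \<kappa> > 0, the sum lies between its largest term exp
  (-\<kappa> m) and \<open>card I\<close> times that term. Hence the soft minimum lies between m -
  ln (card I) / \<kappa> and m.\<close>

lemma tendsto_soft_min:
  fixes s :: "'a \<Rightarrow> real"
  assumes "finite I" "I \<noteq> {}"
  shows "((\<lambda>\<kappa>. - (1 / \<kappa>) * ln (\<Sum>i\<in>I. exp (- \<kappa> * s i))) \<longlongrightarrow> Min (s ` I)) at_top"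
proof (rule tendsto_sandwich)
  let ?m = "Min (s ` I)"
  have "?m \<in> s ` I"
    using assms by simp
  then obtain j where j: "j \<in> I" "s j = ?m"
    by auto
  have card: "card I > 0"
    using assms by (simp add: card_gt_0_iff)
  have bounds: "exp (- \<kappa> * ?m) \<le> (\<Sum>i\<in>I. exp (- \<kappa> * s i))"
    "(\<Sum>i\<in>I. exp (- \<kappa> * s i)) \<le> card I * exp (- \<kappa> * ?m)" if "\<kappa> > 0" for \<kappa>
  proof -
    show "exp (- \<kappa> * ?m) \<le> (\<Sum>i\<in>I. exp (- \<kappa> * s i))"
      using member_le_sum[OF j(1), of "\<lambda>i. exp (- \<kappa> * s i)"] assms j(2) by simp
    show "(\<Sum>i\<in>I. exp (- \<kappa> * s i)) \<le> card I * exp (- \<kappa> * ?m)"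
      using assms that by (intro sum_bounded_above) simp
  qed
  \<comment> \<open>The factor -1/\<kappa> reverses inequalities: the lower bound on the sum gives
    the upper bound here, and vice versa below.\<close>
  show "\<forall>\<^sub>F \<kappa> in at_top. - (1 / \<kappa>) * ln (\<Sum>i\<in>I. exp (- \<kappa> * s i)) \<le> ?m"
    using eventually_gt_at_top[of 0]
  proof eventually_elim
    case (elim \<kappa>)
    have "- \<kappa> * ?m \<le> ln (\<Sum>i\<in>I. exp (- \<kappa> * s i))"
      using bounds(1)[OF elim] by (metis exp_gt_zero ln_exp ln_mono order_less_le_trans)
    with elim show ?case
      by (simp add: field_simps)
  qed
  show "\<forall>\<^sub>F \<kappa> in at_top. ?m - ln (card I) / \<kappa> \<le> - (1 / \<kappa>) * ln (\<Sum>i\<in>I. exp (- \<kappa> * s i))"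
    using eventually_gt_at_top[of 0]
  proof eventually_elim
    case (elim \<kappa>)
    have "(\<Sum>i\<in>I. exp (- \<kappa> * s i)) > 0"
      using bounds(1)[OF elim] by (metis exp_gt_zero order_less_le_trans)
    then have "ln (\<Sum>i\<in>I. exp (- \<kappa> * s i)) \<le> ln (card I * exp (- \<kappa> * ?m))"
      using bounds(2)[OF elim] by (intro ln_mono)
    also have "\<dots> = ln (card I) - \<kappa> * ?m"
      using card by (simp add: ln_mult)
    finally have "ln (\<Sum>i\<in>I. exp (- \<kappa> * s i)) / \<kappa> \<le> (ln (card I) - \<kappa> * ?m) / \<kappa>"
      using elim by (intro divide_right_mono) auto
    with elim show ?case
      by (simp add: diff_divide_distrib)
  qed
  show "((\<lambda>\<kappa>. ?m - ln (card I) / \<kappa>) \<longlongrightarrow> ?m) at_top"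
    using tendsto_diff[OF tendsto_const tendsto_divide_0[OF tendsto_const
      filterlim_at_top_imp_at_infinity[OF filterlim_ident]], of ?m "ln (card I)"]
    by simp
qed simp

lemma limit_belief_cbf_nonneg_iff:
  fixes b :: "('no::finite, 'l::finite) belief"
  shows "0 \<le> limit_belief_cbf h\<^sub>o w \<sigma> x b
    \<longleftrightarrow> card {i. h\<^sub>o x (b $ i) < 0} \<le> risk_index CARD('l) w \<sigma>"
proof -
  define s where "s = (\<lambda>i. h\<^sub>o x (b $ i))"
  \<comment> \<open>The index set does not depend on \<kappa>, so the limit is taken over a fixed
    finite set.\<close>
  define I where "I = top_index_set (risk_index CARD('l) w \<sigma>) s"
  have cbf: "(\<lambda>\<kappa>. belief_cbf h\<^sub>o \<kappa> w \<sigma> x b)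
      = (\<lambda>\<kappa>. if I = {} then \<infinity> else ereal (- (1 / \<kappa>) * ln (\<Sum>i\<in>I. exp (- \<kappa> * s i))))"
    unfolding belief_cbf_def s_def I_def Let_def ..
  have "0 \<le> limit_belief_cbf h\<^sub>o w \<sigma> x b \<longleftrightarrow> (\<forall>i\<in>I. 0 \<le> s i)"
  proof (cases "I = {}")
    \<comment> \<open>The barrier is constantly \<infinity> and the condition on the indices is
      vacuous, so both sides hold.\<close>
    case True
    then show ?thesis
      unfolding limit_belief_cbf_def cbf by (simp add: tendsto_Lim[OF _ tendsto_const])
  next
    case False
    have "((\<lambda>\<kappa>. belief_cbf h\<^sub>o \<kappa> w \<sigma> x b) \<longlongrightarrow> ereal (Min (s ` I))) at_top"
      using tendsto_soft_min[OF _ False] False unfolding cbf by simp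
    then have "limit_belief_cbf h\<^sub>o w \<sigma> x b = ereal (Min (s ` I))"
      unfolding limit_belief_cbf_def by (intro tendsto_Lim) auto
    with False show ?thesis
      by simp
  qed
  then show ?thesis
    unfolding I_def top_index_set_nonneg_iff s_def .
qed

text \<open>An integer is below a floor iff it is below the real number itself, and the cap
  \<open>L\<close> is harmless since n \<le> L.\<close>

lemma le_risk_index_iff:
  assumes "w > 0" "0 < \<sigma>" "\<sigma> < 1" "n \<le> L"
  shows "n \<le> risk_index L w \<sigma> \<longleftrightarrow> w * real n \<le> ln (1 / (1 - \<sigma>))"
proof -
  \<comment> \<open>Nonnegativity ensures that \<open>nat\<close> does not change the floor.\<close>
  have "0 \<le> (1 / w) * ln (1 / (1 - \<sigma>))"
    using assms by simp
  then have "n \<le> risk_index L w \<sigma> \<longleftrightarrow> real n \<le> (1 / w) * ln (1 / (1 - \<sigma>))"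
    using assms(4) unfolding risk_index_def by (simp add: le_nat_floor le_nat_iff le_floor_iff)
  also have "\<dots> \<longleftrightarrow> w * real n \<le> ln (1 / (1 - \<sigma>))"
    using assms(1) by (simp add: field_simps)
  finally show ?thesis .
qed

text \<open>The threshold on the right is free of \<open>w\<close>, so beliefs with different
  weights become comparable.\<close>

lemma mem_safe_set_limit_iff:
  fixes b :: "('no::finite, 'l::finite) belief"
  assumes "w > 0" "0 < \<sigma>" "\<sigma> < 1" "x \<in> X" "b \<in> B" "\<And>i. b $ i \<in> Obj"
  shows "(x, b) \<in> safe_set X B (limit_belief_cbf h\<^sub>o w \<sigma>)
    \<longleftrightarrow> particle_weight (failure_set h\<^sub>o Obj x) w b \<le> ln (1 / (1 - \<sigma>))"
proof -
  let ?N = "card {i. h\<^sub>o x (b $ i) < 0}"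
  have "particle_weight (failure_set h\<^sub>o Obj x) w b = w * real ?N"
    using assms(6) by (simp add: particle_weight_failure_set flip: sum_distrib_left)
  moreover have "?N \<le> CARD('l)"
    by (simp add: card_mono)
  ultimately show ?thesis
    using assms(4,5) le_risk_index_iff[OF assms(1-3)]
    by (simp add: safe_set_def limit_belief_cbf_nonneg_iff)
qed

theorem proposition1:
  fixes X :: "(real^'nx) set"
    and Obj :: "(real^'no) set"
    and B :: "('no::finite, 'l::finite) belief set"
    and h\<^sub>o :: "real^'nx \<Rightarrow> real^'no \<Rightarrow> real"
    and x :: "real^'nx"
    and b_pre b_post :: "('no, 'l) belief"
    and w_pre w_post \<epsilon> \<tau> :: real
  assumes B: "\<And>b i. b \<in> B \<Longrightarrow> b $ i \<in> Obj"
    and smooth: "smooth (\<lambda>(x, y). h\<^sub>o x y)"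
    and weights: "w_pre > 0" "w_post > 0"
    and risk: "0 < \<epsilon>" "\<epsilon> < \<tau>" "\<tau> < 1"
    and states: "x \<in> X" "b_pre \<in> B" "b_post \<in> B"
    and safe_pre: "(x, b_pre) \<in> safe_set X B (limit_belief_cbf h\<^sub>o w_pre (\<tau> - \<epsilon>))"
    and update: "particle_weight (failure_set h\<^sub>o Obj x) w_post b_post
        - particle_weight (failure_set h\<^sub>o Obj x) w_pre b_pre \<le> ln (1 + \<epsilon> / (1 - \<tau>))"
  shows "(x, b_post) \<in> safe_set X B (limit_belief_cbf h\<^sub>o w_post \<tau>)"
proof -
  \<comment> \<open>The criterion applies at the lower level because 0 < \<epsilon> < \<tau> < 1
    puts \<tau> - \<epsilon> in (0, 1).\<close>
  have "particle_weight (failure_set h\<^sub>o Obj x) w_pre b_pre \<le> ln (1 / (1 - (\<tau> - \<epsilon>)))"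
    using safe_pre mem_safe_set_limit_iff[of w_pre "\<tau> - \<epsilon>" x X b_pre B Obj h\<^sub>o]
      weights risk states B by simp
  with update have "particle_weight (failure_set h\<^sub>o Obj x) w_post b_post
      \<le> ln (1 / (1 - (\<tau> - \<epsilon>))) + ln (1 + \<epsilon> / (1 - \<tau>))"
    by simp
  also have "\<dots> = ln (1 / (1 - (\<tau> - \<epsilon>)) * (1 + \<epsilon> / (1 - \<tau>)))"
    using risk by (intro ln_mult_pos[symmetric]) (auto intro: add_pos_pos)
  \<comment> \<open>Since 1 + \<epsilon> / (1 - \<tau>) = (1 - (\<tau> - \<epsilon>)) / (1 -
    \<tau>), the first factor cancels.\<close>
  also have "1 / (1 - (\<tau> - \<epsilon>)) * (1 + \<epsilon> / (1 - \<tau>)) = 1 / (1 - \<tau>)"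
    using risk by (simp add: divide_simps)
  finally show ?thesis
    using mem_safe_set_limit_iff[of w_post \<tau> x X b_post B Obj h\<^sub>o] weights risk states B by simp
qed

end
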